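(* If $G$ is a normal graph with maximum degree $\Delta(G)$, then $\chi'_a(G)\leqslant \frac{5}{2}(\Delta(G)+2)$.
   Context: All graphs are finite, without self-loops or multiple edges, and without isolated vertices. $\Delta(G)$ denotes the maximum degree of a vertex of $G$. A graph $G$ is normal if it contains no isolated edges (an isolated edge is an edge both of whose end vertices have degree $1$, i.e. an edge forming a connected component by itself). An edge $k$-coloring of $G$ is a function $\phi:E(G)\to\{1,2,\ldots,k\}$ such that any two incident edges (edges sharing an end vertex) receive different colors. For an edge coloring $\phi$ and a vertex $v$, $C_\phi(v)$ denotes the set of colors assigned by $\phi$ to the edges incident to $v$. The coloring $\phi$ is an adjacent vertex distinguishing edge coloring if $C_\phi(u)\neq C_\phi(v)$ for every pair of adjacent vertices $u,v$. For a normal graph $G$, the adjacent vertex distinguishing chromatic index $\chi'_a(G)$ is the smallest integer $k$ such that $G$ has an adjacent vertex distinguishing edge $k$-coloring. *)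

theory Defs
  imports Complex_Main "HOL-Library.FuncSet"
begin

text \<open>
  A graph is given by its vertex set and its set of edges, each edge being the two-element set
  of its end vertices. This rules out self-loops and multiple edges.
\<close>

definition incident_edges :: "'a set set \<Rightarrow> 'a \<Rightarrow> 'a set set" where
  "incident_edges E v = {e \<in> E. v \<in> e}"

definition degree :: "'a set set \<Rightarrow> 'a \<Rightarrow> nat" where
  "degree E v = card (incident_edges E v)"

definition graph :: "'a set \<Rightarrow> 'a set set \<Rightarrow> bool" where
  "graph V E \<longleftrightarrow> finite V \<and> (\<forall>e\<in>E. e \<subseteq> V \<and> card e = 2) \<and> (\<forall>v\<in>V. degree E v \<noteq> 0)"

text \<open>The element 0 only matters for the graph without vertices, which has maximum degree 0.\<close>

definition max_degree :: "'a set \<Rightarrow> 'a set set \<Rightarrow> nat" where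
  "max_degree V E = Max (insert 0 (degree E ` V))"

definition isolated_edge :: "'a set set \<Rightarrow> 'a set \<Rightarrow> bool" where
  "isolated_edge E e \<longleftrightarrow> e \<in> E \<and> (\<forall>v\<in>e. degree E v = 1)"

definition normal_graph :: "'a set \<Rightarrow> 'a set set \<Rightarrow> bool" where
  "normal_graph V E \<longleftrightarrow> graph V E \<and> (\<nexists>e. isolated_edge E e)"

definition edge_coloring :: "'a set set \<Rightarrow> nat \<Rightarrow> ('a set \<Rightarrow> nat) \<Rightarrow> bool" where
  "edge_coloring E k \<phi> \<longleftrightarrow>
     \<phi> \<in> E \<rightarrow> {1..k} \<and> (\<forall>e\<in>E. \<forall>f\<in>E. e \<noteq> f \<and> e \<inter> f \<noteq> {} \<longrightarrow> \<phi> e \<noteq> \<phi> f)"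

definition color_set :: "'a set set \<Rightarrow> ('a set \<Rightarrow> nat) \<Rightarrow> 'a \<Rightarrow> nat set" where
  "color_set E \<phi> v = \<phi> ` incident_edges E v"

definition avd_edge_coloring :: "'a set set \<Rightarrow> nat \<Rightarrow> ('a set \<Rightarrow> nat) \<Rightarrow> bool" where
  "avd_edge_coloring E k \<phi> \<longleftrightarrow>
     edge_coloring E k \<phi> \<and> (\<forall>u v. {u, v} \<in> E \<longrightarrow> color_set E \<phi> u \<noteq> color_set E \<phi> v)"

definition avd_chromatic_index :: "'a set set \<Rightarrow> nat" where
  "avd_chromatic_index E = (LEAST k. \<exists>\<phi>. avd_edge_coloring E k \<phi>)"

text \<open>For a normal graph the minimum defining the index is taken over a nonempty set.\<close>

lemma ex_avd_edge_coloring: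
  assumes "normal_graph V E"
  shows "\<exists>k \<phi>. avd_edge_coloring E k \<phi>"
proof -
  have fV: "finite V" and E: "\<And>e. e \<in> E \<Longrightarrow> e \<subseteq> V \<and> card e = 2"
    and iso: "\<And>e. \<not> isolated_edge E e"
    using assms by (auto simp: normal_graph_def graph_def)
  have "E \<subseteq> Pow V" using E by blast
  then have "finite E" using fV by (simp add: finite_subset)
  then obtain h where h: "bij_betw h E {1..card E}"
    using ex_bij_betw_finite_nat[of E] finite_same_card_bij[of E "{1..card E}"] by auto
  then have inj: "inj_on h E" and im: "h ` E = {1..card E}"
    by (auto simp: bij_betw_def)
  have dist: "color_set E h u \<noteq> color_set E h v" if uv: "{u, v} \<in> E" for u v
  proof
    assume "color_set E h u = color_set E h v"
    then have eq: "incident_edges E u = incident_edges E v"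
      unfolding color_set_def
      using inj_on_image_eq_iff[OF inj, of "incident_edges E u" "incident_edges E v"]
      by (auto simp: incident_edges_def)
    have ne: "u \<noteq> v" using E[OF uv] by auto
    have only: "e = {u, v}" if "e \<in> incident_edges E u" for e
    proof -
      have "e \<in> E" "u \<in> e" "v \<in> e" using that eq by (auto simp: incident_edges_def)
      moreover from this have "card e = 2" using E by blast
      ultimately show ?thesis using ne by (auto simp: card_2_iff)
    qed
    have "incident_edges E u = {{u, v}}"
      using only uv by (auto simp: incident_edges_def)
    then have "isolated_edge E {u, v}"
      using eq uv by (auto simp: isolated_edge_def degree_def)
    then show False using iso by blast
  qed
  have "avd_edge_coloring E (card E) h"
    unfolding avd_edge_coloring_def edge_coloring_def
    using dist im inj by (auto dest: inj_onD)
  then show ?thesis by blast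
qed

end

theory Submission
  imports Defs
begin

text \<open>
  The edges are colored greedily with \<open>K = \<lfloor>5/2 (\<Delta> + 2)\<rfloor>\<close> colors, in an order in which every edge
  meets a still uncolored one, except for the second edges of some adjacent pairs; the first edge
  of such a pair is used to make the ends of the second one differ.
  Besides the at most \<open>2\<Delta> - 2\<close> colors on adjacent edges, an edge \<open>xz\<close> must avoid the colors \<open>b\<close> for
  which some completed neighbor \<open>y\<close> of \<open>x\<close> has \<open>C(y) = C(x) \<union> {b}\<close>. If \<open>x\<close> has more than four such
  colors, recolor one edge \<open>xy\<close> of this kind: as \<open>C(x) \<subseteq> C(y)\<close>, at most \<open>2\<Delta>\<close> colors are forbidden for
  it, so about \<open>\<Delta>/2\<close> are left, and by averaging one of them leaves at most four bad colors at \<open>x\<close>.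
\<close>

section \<open>Finite color sets and changes of an edge coloring at one edge\<close>

lemma finite_ex_notin:
  fixes F :: "nat set"
  assumes "finite F" "card F < K"
  obtains b where "b \<in> {1..K}" "b \<notin> F"
proof -
  have "\<not> {1..K} \<subseteq> F"
    using card_mono[OF assms(1), of "{1..K}"] assms(2) by auto
  then show ?thesis using that by blast
qed

text \<open>Such a \<open>b\<close> must be the single element of \<open>B - A\<close>, which
  \<open>Min\<close> merely names. Hence forbidding a vertex to reach one prescribed color set costs
  at most one color.\<close>

lemma finite_insert_eq:
  fixes A B :: "nat set"
  shows "finite {b. b \<notin> A \<and> insert b A = B}" (is "finite ?S")
    and "card {b. b \<notin> A \<and> insert b A = B} \<le> 1"
proof -
  have sub: "?S \<subseteq> {Min (B - A)}"
  proof
    fix b assume "b \<in> ?S"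
    then have "B - A = {b}" by auto
    then show "b \<in> {Min (B - A)}" by simp
  qed
  then show "finite ?S" using finite_subset by blast
  show "card ?S \<le> 1" using card_mono[OF _ sub] by simp
qed

lemma card_2_other_element:
  assumes "card e = 2" "z \<in> e"
  obtains x where "e = {x, z}"
  using assms by (auto simp: card_2_iff)

lemma incident_edges_mono: "D \<subseteq> E \<Longrightarrow> incident_edges D v \<subseteq> incident_edges E v"
  by (auto simp: incident_edges_def)

lemma edge_coloring_mono: "edge_coloring E k \<phi> \<Longrightarrow> D \<subseteq> E \<Longrightarrow> edge_coloring D k \<phi>"
  unfolding edge_coloring_def by blast

lemma color_set_insert:
  assumes "e \<notin> D"
  shows "color_set (insert e D) (\<phi>(e := b)) v =
    (if v \<in> e then insert b (color_set D \<phi> v) else color_set D \<phi> v)"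
proof -
  have "incident_edges (insert e D) v =
    (if v \<in> e then insert e (incident_edges D v) else incident_edges D v)"
    by (auto simp: incident_edges_def)
  moreover have "(\<phi>(e := b)) ` incident_edges D v = \<phi> ` incident_edges D v"
    using assms by (auto simp: incident_edges_def)
  ultimately show ?thesis
    by (cases "v \<in> e") (simp_all only: color_set_def if_True if_False image_insert fun_upd_same)
qed

lemma color_set_remove:
  assumes "edge_coloring D k \<phi>" "e \<in> D"
  shows "color_set (D - {e}) \<phi> v =
    (if v \<in> e then color_set D \<phi> v - {\<phi> e} else color_set D \<phi> v)"
  using assms unfolding color_set_def edge_coloring_def incident_edges_def by auto

lemma finite_color_set: "finite D \<Longrightarrow> finite (color_set D \<phi> v)"
  by (simp add: color_set_def incident_edges_def)

lemma card_color_set_le: "finite D \<Longrightarrow> card (color_set D \<phi> v) \<le> degree D v"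
  unfolding color_set_def degree_def by (rule card_image_le) (simp add: incident_edges_def)

definition neighbors :: "'a set set \<Rightarrow> 'a \<Rightarrow> 'a set" where
  "neighbors E x = {y. {x, y} \<in> E}"

lemma finite_neighbors:
  assumes "finite E"
  shows "finite (neighbors E x)" "card (neighbors E x) \<le> degree E x"
proof -
  have inj: "inj_on (\<lambda>y. {x, y}) (neighbors E x)"
    by (auto simp: inj_on_def doubleton_eq_iff)
  have sub: "(\<lambda>y. {x, y}) ` neighbors E x \<subseteq> incident_edges E x"
    by (auto simp: neighbors_def incident_edges_def)
  have fin: "finite (incident_edges E x)"
    using assms by (simp add: incident_edges_def)
  show "finite (neighbors E x)"
    using inj_on_finite[OF inj sub fin] .
  show "card (neighbors E x) \<le> degree E x"
    unfolding degree_def using card_inj_on_le[OF inj sub fin] .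
qed

section \<open>Partial colorings from a fixed palette\<close>

text \<open>The lower bound on \<open>K\<close> is the integer part of 5/2 (\<Delta> + 2), split
  into the 2\<Delta> colors that a greedy step may lose and a surplus of
  \<open>\<Delta> div 2 + 5\<close>.\<close>

locale avd_palette =
  fixes E :: "'a set set" and \<Delta> K :: nat
  assumes finite_E: "finite E"
    and card_edge: "e \<in> E \<Longrightarrow> card e = 2"
    and degree_le: "degree E v \<le> \<Delta>"
    and palette: "2 * \<Delta> + \<Delta> div 2 + 5 \<le> K"
begin

definition saturated :: "'a set set \<Rightarrow> 'a \<Rightarrow> bool" where
  "saturated D v \<longleftrightarrow> incident_edges E v \<subseteq> D"

text \<open>Only saturated vertices are compared, because the color sets of the others can still
  grow.\<close>

definition partial_avd :: "'a set set \<Rightarrow> ('a set \<Rightarrow> nat) \<Rightarrow> bool" where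
  "partial_avd D \<phi> \<longleftrightarrow> D \<subseteq> E \<and> edge_coloring D K \<phi> \<and>
     (\<forall>u v. {u, v} \<in> E \<and> saturated D u \<and> saturated D v \<longrightarrow> color_set D \<phi> u \<noteq> color_set D \<phi> v)"

text \<open>The colors that would make \<open>x\<close> clash with a saturated neighbor if the last uncolored edge
  at \<open>x\<close> received them.\<close>

definition danger :: "'a set set \<Rightarrow> ('a set \<Rightarrow> nat) \<Rightarrow> 'a \<Rightarrow> nat set" where
  "danger D \<phi> x = {b. b \<notin> color_set D \<phi> x \<and>
     (\<exists>y. {x, y} \<in> D \<and> saturated D y \<and> color_set D \<phi> y = insert b (color_set D \<phi> x))}"

lemma edge_neq: "{x, y} \<in> E \<Longrightarrow> x \<noteq> y"
  using card_edge by fastforce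

lemma saturated_edge: "saturated D y \<Longrightarrow> {x, y} \<in> E \<Longrightarrow> {x, y} \<in> D"
  by (auto simp: saturated_def incident_edges_def)

lemma saturated_insert: "v \<notin> e \<Longrightarrow> saturated (insert e D) v \<longleftrightarrow> saturated D v"
  by (auto simp: saturated_def incident_edges_def)

lemma finite_sub: "D \<subseteq> E \<Longrightarrow> finite D"
  using finite_E finite_subset by blast

lemma degree_sub_le:
  assumes "D \<subseteq> E"
  shows "degree D v \<le> \<Delta>"
proof -
  have "degree D v \<le> degree E v"
    unfolding degree_def using finite_E incident_edges_mono[OF assms]
    by (intro card_mono) (auto simp: incident_edges_def)
  then show ?thesis using degree_le le_trans by blast
qed

lemma degree_unsaturated_less:
  assumes "D \<subseteq> E" "\<not> saturated D v"
  shows "degree D v < \<Delta>"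
proof -
  have "incident_edges D v \<subset> incident_edges E v"
    using assms by (auto simp: saturated_def incident_edges_def)
  then have "degree D v < degree E v"
    unfolding degree_def using finite_E by (intro psubset_card_mono) (auto simp: incident_edges_def)
  then show ?thesis using degree_le[of v] by linarith
qed

lemma unsaturatedI: "e \<in> E \<Longrightarrow> e \<notin> D \<Longrightarrow> v \<in> e \<Longrightarrow> \<not> saturated D v"
  by (auto simp: saturated_def incident_edges_def)

text \<open>A neighbor \<open>y\<close> contributes at most one color, namely the single element of
  C(y) - C(x).\<close>

lemma finite_danger:
  assumes "D \<subseteq> E"
  shows "finite (danger D \<phi> x)" "card (danger D \<phi> x) \<le> degree D x"
proof -
  let ?g = "\<lambda>y. Min (color_set D \<phi> y - color_set D \<phi> x)"
  have sub: "danger D \<phi> x \<subseteq> ?g ` neighbors D x"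
  proof
    fix b assume "b \<in> danger D \<phi> x"
    then obtain y where b: "b \<notin> color_set D \<phi> x" and y: "{x, y} \<in> D"
      and eq: "color_set D \<phi> y = insert b (color_set D \<phi> x)"
      by (auto simp: danger_def)
    have "color_set D \<phi> y - color_set D \<phi> x = {b}" using b eq by auto
    then have "b = ?g y" by simp
    then show "b \<in> ?g ` neighbors D x" using y by (auto simp: neighbors_def)
  qed
  note fin = finite_neighbors[OF finite_sub[OF assms], of x]
  show "finite (danger D \<phi> x)" using sub fin(1) finite_surj by blast
  show "card (danger D \<phi> x) \<le> degree D x"
    using surj_card_le[OF fin(1) sub] fin(2) by linarith
qed

text \<open>A vertex saturated in \<open>D'\<close> has lost none of its edges, so it was saturated
  in \<open>D\<close> with the same color set.\<close>

lemma partial_avd_sub: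
  assumes "partial_avd D \<phi>" "D' \<subseteq> D"
  shows "partial_avd D' \<phi>"
proof -
  have D: "D \<subseteq> E" using assms by (simp add: partial_avd_def)
  have sat: "saturated D v \<and> color_set D' \<phi> v = color_set D \<phi> v" if "saturated D' v" for v
  proof -
    have "incident_edges D' v = incident_edges D v"
      using that D assms(2) by (auto simp: saturated_def incident_edges_def)
    then show ?thesis using that assms(2) by (auto simp: saturated_def color_set_def)
  qed
  show ?thesis
    using assms D sat edge_coloring_mono[of D K \<phi> D'] unfolding partial_avd_def by auto
qed

text \<open>Only the color sets of \<open>x\<close> and \<open>z\<close> change. A clash of one of
  them with a third vertex is what \<open>danger\<close> excludes; a clash between them would have
  existed before, since both gain the same new color.\<close>

lemma partial_avd_insert:
  assumes par: "partial_avd D \<phi>" and e: "{x, z} \<in> E" "{x, z} \<notin> D"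
    and b: "b \<in> {1..K}" "b \<notin> color_set D \<phi> x" "b \<notin> color_set D \<phi> z"
    and x: "saturated (insert {x, z} D) x \<Longrightarrow> b \<notin> danger D \<phi> x"
    and z: "saturated (insert {x, z} D) z \<Longrightarrow> b \<notin> danger D \<phi> z"
    and xz: "saturated (insert {x, z} D) x \<Longrightarrow> saturated (insert {x, z} D) z \<Longrightarrow>
      color_set D \<phi> x \<noteq> color_set D \<phi> z"
  shows "partial_avd (insert {x, z} D) (\<phi>({x, z} := b))"
proof -
  let ?D = "insert {x, z} D" and ?\<phi> = "\<phi>({x, z} := b)"
  have D: "D \<subseteq> E" and col: "edge_coloring D K \<phi>"
    and dist: "\<And>u v. {u, v} \<in> E \<Longrightarrow> saturated D u \<Longrightarrow> saturated D v \<Longrightarrow>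
      color_set D \<phi> u \<noteq> color_set D \<phi> v"
    using par by (auto simp: partial_avd_def)
  have cs: "color_set ?D ?\<phi> v =
    (if v \<in> {x, z} then insert b (color_set D \<phi> v) else color_set D \<phi> v)" for v
    using color_set_insert[OF e(2)] .
  have nb: "\<phi> f \<noteq> b" if "f \<in> D" "f \<inter> {x, z} \<noteq> {}" for f
    using that b by (auto simp: color_set_def incident_edges_def)
  have proper: "?\<phi> f \<noteq> ?\<phi> g" if "f \<in> ?D" "g \<in> ?D" "f \<noteq> g" "f \<inter> g \<noteq> {}" for f g
  proof (cases "f = {x, z} \<or> g = {x, z}")
    case True
    then show ?thesis using that nb[of f] nb[of g] e(2) by (auto simp: Int_commute)
  next
    case False
    then show ?thesis using that col by (auto simp: edge_coloring_def)
  qed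
  have "?\<phi> \<in> ?D \<rightarrow> {1..K}" using col b(1) by (auto simp: edge_coloring_def)
  then have col': "edge_coloring ?D K ?\<phi>"
    unfolding edge_coloring_def using proper by blast
  have end_dist: "color_set ?D ?\<phi> u \<noteq> color_set ?D ?\<phi> w"
    if "u \<in> {x, z}" "w \<notin> {x, z}" "{u, w} \<in> E" "saturated ?D u" "saturated ?D w" for u w
  proof
    assume eq: "color_set ?D ?\<phi> u = color_set ?D ?\<phi> w"
    have w: "saturated D w" using saturated_insert[OF that(2)] that(5) by simp
    have "color_set D \<phi> w = insert b (color_set D \<phi> u)"
      using eq unfolding cs by (simp only: that(1,2) if_True if_False)
    moreover have "b \<notin> color_set D \<phi> u" using that(1) b by blast
    ultimately have "b \<in> danger D \<phi> u"
      unfolding danger_def using w saturated_edge[OF w that(3)] by blast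
    then show False using that(1,4) x z by blast
  qed
  have "color_set ?D ?\<phi> u \<noteq> color_set ?D ?\<phi> w"
    if uw: "{u, w} \<in> E" "saturated ?D u" "saturated ?D w" for u w
  proof -
    consider "u \<in> {x, z}" "w \<in> {x, z}" | "u \<in> {x, z}" "w \<notin> {x, z}"
      | "u \<notin> {x, z}" "w \<in> {x, z}" | "u \<notin> {x, z}" "w \<notin> {x, z}" by blast
    then show ?thesis
    proof cases
      case 1
      have "u \<noteq> w" using uw edge_neq by blast
      moreover have "insert b (color_set D \<phi> x) \<noteq> insert b (color_set D \<phi> z)"
        if "color_set D \<phi> x \<noteq> color_set D \<phi> z"
        using that b by (simp add: insert_ident)
      ultimately show ?thesis using 1 uw xz cs[of u] cs[of w] by auto
    next
      case 2
      then show ?thesis using uw end_dist by blast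
    next
      case 3
      then show ?thesis using uw end_dist[of w u] by (simp add: insert_commute)
    next
      case 4
      then show ?thesis using uw dist cs saturated_insert by auto
    qed
  qed
  then show ?thesis using D e(1) col' by (auto simp: partial_avd_def)
qed

section \<open>Recoloring an edge at an unsaturated vertex\<close>

text \<open>Uncolor the edge and insert it again. As \<open>x\<close> stays unsaturated, clashes can
  arise only at \<open>y\<close>.\<close>

lemma recolor_edge:
  assumes par: "partial_avd D \<phi>" and e: "{x, y} \<in> D" and x: "\<not> saturated D x"
    and b: "b \<in> {1..K}" "b \<notin> color_set D \<phi> x" "b \<notin> color_set D \<phi> y"
      "b \<notin> danger (D - {{x, y}}) \<phi> y"
  shows "partial_avd D (\<phi>({x, y} := b))"
    and "color_set D (\<phi>({x, y} := b)) v =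
      (if v \<in> {x, y} then insert b (color_set D \<phi> v - {\<phi> {x, y}}) else color_set D \<phi> v)"
proof -
  let ?D = "D - {{x, y}}"
  have D: "D \<subseteq> E" and col: "edge_coloring D K \<phi>" using par by (auto simp: partial_avd_def)
  have ins: "insert {x, y} ?D = D" using e by blast
  have rem: "color_set ?D \<phi> v =
      (if v \<in> {x, y} then color_set D \<phi> v - {\<phi> {x, y}} else color_set D \<phi> v)" for v
    using color_set_remove[OF col e] .
  have "partial_avd ?D \<phi>" using partial_avd_sub[OF par] by blast
  then have "partial_avd (insert {x, y} ?D) (\<phi>({x, y} := b))"
    using D e b x by (intro partial_avd_insert) (simp_all add: rem insert_absorb subsetD)
  then show "partial_avd D (\<phi>({x, y} := b))" by (simp only: ins)
  show "color_set D (\<phi>({x, y} := b)) v =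
      (if v \<in> {x, y} then insert b (color_set D \<phi> v - {\<phi> {x, y}}) else color_set D \<phi> v)"
    using color_set_insert[of "{x, y}" ?D \<phi> b v, unfolded ins rem] by simp
qed

text \<open>\<open>Q\<close> serves to keep C(x) different from the color set at the other end of an
  edge. The last conclusion allows treating both ends of an edge in turn.\<close>

lemma reduce_danger:
  assumes par: "partial_avd D \<phi>" and x: "\<not> saturated D x"
  obtains \<phi>' where "partial_avd D \<phi>'" "card (danger D \<phi>' x) \<le> 4"
    "color_set D \<phi> x \<noteq> Q \<Longrightarrow> color_set D \<phi>' x \<noteq> Q"
    "\<And>v. \<not> saturated D v \<Longrightarrow> v \<noteq> x \<Longrightarrow>
      color_set D \<phi>' v = color_set D \<phi> v \<and> card (danger D \<phi>' v) \<le> card (danger D \<phi> v) + 1"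
proof (cases "card (danger D \<phi> x) \<le> 4")
  case True
  then show ?thesis using that[of \<phi>] par by simp
next
  case False
  have D: "D \<subseteq> E" and col: "edge_coloring D K \<phi>" using par by (auto simp: partial_avd_def)
  note finD = finite_sub[OF D]
  have "danger D \<phi> x \<noteq> {}" using False by auto
  then obtain y b0 where b0: "b0 \<notin> color_set D \<phi> x" and xy: "{x, y} \<in> D" and y: "saturated D y"
    and Cy: "color_set D \<phi> y = insert b0 (color_set D \<phi> x)"
    by (auto simp: danger_def)
  define c where "c = \<phi> {x, y}"
  \<comment> \<open>The colors that remain at \<open>x\<close> when the edge \<open>{x, y}\<close>
    is recolored.\<close>
  define R where "R = color_set D \<phi> x - {c}"
  \<comment> \<open>Since C(x) is contained in C(y), the first set also ensures properness at
    \<open>x\<close>. The last set holds the at most one color that would turn C(x) into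
    \<open>Q\<close>.\<close>
  define F where "F = color_set D \<phi> y \<union> danger (D - {{x, y}}) \<phi> y \<union> {b. b \<notin> R \<and> insert b R = Q}"
  define A where "A = {1..K} - F"
  \<comment> \<open>These neighbors have color set \<open>R\<close> plus \<open>a\<close> plus one
    further color, so they may become dangerous once C(x) is \<open>insert a R\<close>.\<close>
  define N where "N a = {y' \<in> neighbors D x. a \<in> color_set D \<phi> y' - R \<and>
    card (color_set D \<phi> y' - R) = 2}" for a
  have cx: "c \<in> color_set D \<phi> x" using xy by (auto simp: c_def color_set_def incident_edges_def)
  have finF: "finite F" and cardF: "card F \<le> 2 * \<Delta>"
  proof -
    let ?D = "D - {{x, y}}"
    have sub: "?D \<subseteq> E" using D by blast
    have ny: "\<not> saturated ?D y" using xy D by (intro unsaturatedI[of "{x, y}"]) auto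
    note fd = finite_danger[OF sub, of \<phi> y]
    note fi = finite_insert_eq[of R Q]
    show "finite F" using fd fi finite_color_set[OF finD] by (simp add: F_def)
    have "card F \<le> card (color_set D \<phi> y) + card (danger ?D \<phi> y) + card {b. b \<notin> R \<and> insert b R = Q}"
      unfolding F_def by (meson add_le_mono card_Un_le le_refl le_trans)
    moreover have "card (color_set D \<phi> y) \<le> \<Delta>"
      using card_color_set_le[OF finD, of \<phi> y] degree_sub_le[OF D, of y] by linarith
    moreover have "card (danger ?D \<phi> y) < \<Delta>"
      using fd(2) degree_unsaturated_less[OF sub ny] by linarith
    ultimately show "card F \<le> 2 * \<Delta>" using fi(2) by linarith
  qed
  have cardA: "\<Delta> div 2 + 5 \<le> card A"
  proof -
    have "card {1..K} - card F \<le> card A"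
      unfolding A_def using finF by (rule diff_card_le_card_Diff)
    then show ?thesis using cardF palette by simp
  qed
  note nb = finite_neighbors[OF finD, of x]
  \<comment> \<open>Each neighbor occurs in at most two of the sets \<open>N a\<close>, so some \<open>N a\<close> is small.\<close>
  have "\<exists>a\<in>A. card (N a) \<le> 3"
  proof (rule ccontr)
    assume neg: "\<not> ?thesis"
    have "4 * card A = (\<Sum>a\<in>A. 4)" by simp
    also have "\<dots> \<le> (\<Sum>a\<in>A. card (N a))" using neg by (intro sum_mono) auto
    also have "\<dots> = (\<Sum>y'\<in>neighbors D x. card {a \<in> A. a \<in> color_set D \<phi> y' - R \<and>
        card (color_set D \<phi> y' - R) = 2})"
      unfolding N_def using nb by (intro sum_multicount_gen) (auto simp: A_def)
    also have "\<dots> \<le> (\<Sum>y'\<in>neighbors D x. 2)"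
    proof (rule sum_mono)
      fix y'
      show "card {a \<in> A. a \<in> color_set D \<phi> y' - R \<and> card (color_set D \<phi> y' - R) = 2} \<le> 2"
      proof (cases "card (color_set D \<phi> y' - R) = 2")
        case True
        have "card {a \<in> A. a \<in> color_set D \<phi> y' - R} \<le> card (color_set D \<phi> y' - R)"
          using finite_color_set[OF finD] by (intro card_mono) auto
        then show ?thesis using True by simp
      qed simp
    qed
    \<comment> \<open>This contradicts \<open>cardA\<close>, which gives 4 |A| \<ge> 2\<Delta> +
      18.\<close>
    also have "\<dots> \<le> 2 * \<Delta>" using nb(2) degree_sub_le[OF D, of x] by simp
    finally show False using cardA by linarith
  qed
  then obtain a where a: "a \<in> A" and Na: "card (N a) \<le> 3" by blast
  have a_props: "a \<in> {1..K}" "a \<notin> color_set D \<phi> x" "a \<notin> color_set D \<phi> y"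
    "a \<notin> danger (D - {{x, y}}) \<phi> y" "insert a R \<noteq> Q"
    using a Cy by (auto simp: A_def F_def R_def)
  define \<psi> where "\<psi> = \<phi>({x, y} := a)"
  have par': "partial_avd D \<psi>"
    unfolding \<psi>_def using recolor_edge(1)[OF par xy x] a_props by blast
  have cs: "color_set D \<psi> v = (if v \<in> {x, y} then insert a (color_set D \<phi> v - {c}) else color_set D \<phi> v)"
    for v
    unfolding \<psi>_def c_def using recolor_edge(2)[OF par xy x] a_props by blast
  have csx: "color_set D \<psi> x = insert a R" by (simp add: cs R_def)
  have aR: "a \<notin> R" using a_props by (simp add: R_def)
  have b0R: "b0 \<notin> R" using b0 by (simp add: R_def)
  have csy: "color_set D \<psi> y = insert b0 (insert a R)"
    using cs[of y] Cy cx b0 by (auto simp: R_def)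
  have "card (danger D \<psi> x) \<le> 4"
  proof -
    let ?g = "\<lambda>y'. Min (color_set D \<phi> y' - R - {a})"
    \<comment> \<open>The recolored neighbor \<open>y\<close> still endangers \<open>x\<close>
      through \<open>b0\<close>; any other dangerous neighbor kept its color set and lies in
      \<open>N a\<close>. This gives 1 + 3 = 4.\<close>
    have "danger D \<psi> x \<subseteq> insert b0 (?g ` N a)"
    proof
      fix b assume "b \<in> danger D \<psi> x"
      then obtain y' where b: "b \<notin> insert a R" and y': "{x, y'} \<in> D"
        and eq: "color_set D \<psi> y' = insert b (insert a R)"
        by (auto simp: danger_def csx)
      show "b \<in> insert b0 (?g ` N a)"
      proof (cases "y' = y")
        case True
        then show ?thesis using eq csy b by auto
      next
        case False
        moreover have "y' \<noteq> x" using y' D edge_neq by blast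
        ultimately have "color_set D \<phi> y' = insert b (insert a R)" using eq cs[of y'] by simp
        then have diff: "color_set D \<phi> y' - R = {b, a}" using b aR by auto
        then have "y' \<in> N a" using y' b by (simp add: N_def neighbors_def del: Diff_iff)
        moreover have "color_set D \<phi> y' - R - {a} = {b}" using diff b by auto
        then have "b = ?g y'" by simp
        ultimately show ?thesis by blast
      qed
    qed
    moreover have "finite (N a)" using nb(1) by (simp add: N_def)
    ultimately have "card (danger D \<psi> x) \<le> card (insert b0 (?g ` N a))"
      by (intro card_mono) auto
    also have "\<dots> \<le> Suc (card (?g ` N a))" by (rule card_insert_le_m1) auto
    also have "\<dots> \<le> Suc (card (N a))" using \<open>finite (N a)\<close> card_image_le by blast
    finally show ?thesis using Na by simp
  qed
  moreover have "color_set D \<psi> v = color_set D \<phi> v \<and> card (danger D \<psi> v) \<le> card (danger D \<phi> v) + 1"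
    if v: "\<not> saturated D v" "v \<noteq> x" for v
  proof -
    have csv: "color_set D \<psi> v = color_set D \<phi> v" using v y cs[of v] by auto
    let ?S = "{b. b \<notin> color_set D \<phi> v \<and> insert b (color_set D \<phi> v) = color_set D \<psi> y}"
    \<comment> \<open>Among saturated vertices only \<open>y\<close> changed its color set, so at
      most one color is new.\<close>
    have "danger D \<psi> v \<subseteq> danger D \<phi> v \<union> ?S"
    proof
      fix b assume "b \<in> danger D \<psi> v"
      then obtain y' where b: "b \<notin> color_set D \<phi> v" and y': "{v, y'} \<in> D" "saturated D y'"
        and eq: "color_set D \<psi> y' = insert b (color_set D \<phi> v)"
        by (auto simp: danger_def csv)
      show "b \<in> danger D \<phi> v \<union> ?S"
      proof (cases "y' = y")
        case True
        then show ?thesis using b eq by simp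
      next
        case False
        moreover have "y' \<noteq> x" using x y' by blast
        ultimately have "color_set D \<phi> y' = insert b (color_set D \<phi> v)" using eq cs[of y'] by simp
        then show ?thesis using b y' by (auto simp: danger_def)
      qed
    qed
    then have "card (danger D \<psi> v) \<le> card (danger D \<phi> v \<union> ?S)"
      using finite_danger(1)[OF D] finite_insert_eq(1) by (intro card_mono) blast+
    also have "\<dots> \<le> card (danger D \<phi> v) + 1"
      using card_Un_le[of "danger D \<phi> v" ?S] finite_insert_eq(2)[of "color_set D \<phi> v" "color_set D \<psi> y"]
      by linarith
    finally show ?thesis using csv by blast
  qed
  ultimately show ?thesis using that[of \<psi>] par' a_props(5) csx by auto
qed

section \<open>Coloring one more edge\<close>

lemma card_color_set_less:
  assumes "D \<subseteq> E" "\<not> saturated D v"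
  shows "card (color_set D \<phi> v) < \<Delta>"
  using card_color_set_le[OF finite_sub[OF assms(1)], of \<phi> v] degree_unsaturated_less[OF assms]
  by linarith

text \<open>Making \<open>z\<close> and \<open>v\<close> differ prepares the coloring of the edge \<open>{z, v}\<close>.\<close>

lemma color_nonfinal_edge:
  assumes par: "partial_avd D \<phi>" and xz: "{x, z} \<in> E" "{x, z} \<notin> D"
    and zv: "{z, v} \<in> E" "{z, v} \<notin> D" "v \<noteq> x"
  obtains \<phi>' where "partial_avd (insert {x, z} D) \<phi>'"
    "color_set (insert {x, z} D) \<phi>' z \<noteq> color_set (insert {x, z} D) \<phi>' v"
proof -
  have D: "D \<subseteq> E" using par by (simp add: partial_avd_def)
  have ux: "\<not> saturated D x" and uz: "\<not> saturated D z" using unsaturatedI[OF xz] by simp_all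
  \<comment> \<open>The edge \<open>{z, v}\<close> stays uncolored, so only the danger at
    \<open>x\<close> has to be avoided.\<close>
  have uz': "\<not> saturated (insert {x, z} D) z"
    using zv by (intro unsaturatedI[of "{z, v}"]) (auto simp: doubleton_eq_iff)
  obtain \<psi> where psi: "partial_avd D \<psi>" "card (danger D \<psi> x) \<le> 4"
    using reduce_danger[OF par ux] by metis
  \<comment> \<open>The color that would make C(z) equal to C(v); C(v) itself stays fixed because
    \<open>v\<close> is not an end of \<open>{x, z}\<close>.\<close>
  let ?S = "{b. b \<notin> color_set D \<psi> z \<and> insert b (color_set D \<psi> z) = color_set D \<psi> v}"
  let ?F = "color_set D \<psi> x \<union> color_set D \<psi> z \<union> danger D \<psi> x \<union> ?S"
  have "card ?F \<le> card (color_set D \<psi> x) + card (color_set D \<psi> z) + card (danger D \<psi> x) + card ?S"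
    by (meson add_le_mono card_Un_le le_refl le_trans)
  \<comment> \<open>The sum is at most 2 (\<Delta> - 1) + 4 + 1 = 2\<Delta> + 3.\<close>
  also have "\<dots> < K"
    using card_color_set_less[OF D ux, of \<psi>] card_color_set_less[OF D uz, of \<psi>] psi(2) palette
      finite_insert_eq(2)[of "color_set D \<psi> z" "color_set D \<psi> v"] by linarith
  finally have card_F: "card ?F < K" .
  have "finite ?F"
    using finite_color_set[OF finite_sub[OF D]] finite_danger(1)[OF D] finite_insert_eq(1) by blast
  then obtain b where b: "b \<in> {1..K}" "b \<notin> ?F" by (rule finite_ex_notin[OF _ card_F])
  have "partial_avd (insert {x, z} D) (\<psi>({x, z} := b))"
    using partial_avd_insert[OF psi(1) xz b(1)] b(2) uz' by blast
  moreover have "v \<noteq> z" using zv edge_neq by blast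
  ultimately show ?thesis
    using that[of "\<psi>({x, z} := b)"] b zv(3) color_set_insert[OF xz(2), of \<psi> b] by auto
qed

text \<open>Both ends may become saturated, so the dangers at both count. Their color sets must
  differ beforehand, since a common new color cannot separate them.\<close>

lemma color_final_edge:
  assumes par: "partial_avd D \<phi>" and uv: "{u, v} \<in> E" "{u, v} \<notin> D"
    and neq: "color_set D \<phi> u \<noteq> color_set D \<phi> v"
  obtains \<phi>' where "partial_avd (insert {u, v} D) \<phi>'"
proof -
  have D: "D \<subseteq> E" using par by (simp add: partial_avd_def)
  have u: "\<not> saturated D u" and v: "\<not> saturated D v" using unsaturatedI[OF uv] by simp_all
  have uv_neq: "u \<noteq> v" using uv edge_neq by blast
  \<comment> \<open>The two color sets have at most \<Delta> - 1 elements each, so the inequality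
    says that fewer than \<open>K\<close> colors are forbidden.\<close>
  obtain \<psi> where psi: "partial_avd D \<psi>" "color_set D \<psi> u \<noteq> color_set D \<psi> v"
    "card (danger D \<psi> u) + card (danger D \<psi> v) + 2 * \<Delta> < K + 2"
  \<comment> \<open>Up to 5 the trivial bound \<Delta> - 1 on each danger suffices: 4\<Delta> - 4 <
    \<open>K\<close>. From 6 on, the surplus \<open>\<Delta> div 2 + 5\<close> is at least 8 and
    pays for dangers 5 and 4.\<close>
  proof (cases "\<Delta> \<le> 5")
    case True
    have "card (danger D \<phi> u) < \<Delta>" "card (danger D \<phi> v) < \<Delta>"
      using finite_danger(2)[OF D] degree_unsaturated_less[OF D] u v le_less_trans by blast+
    moreover have "4 * \<Delta> < 2 * \<Delta> + \<Delta> div 2 + 9" using True by linarith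
    ultimately show ?thesis using that[of \<phi>] par neq palette by linarith
  next
    case False
    obtain \<phi>1 where p1: "partial_avd D \<phi>1" "card (danger D \<phi>1 u) \<le> 4"
      "color_set D \<phi>1 u \<noteq> color_set D \<phi> v" "color_set D \<phi>1 v = color_set D \<phi> v"
      using reduce_danger[OF par u, of "color_set D \<phi> v"] neq v uv_neq by metis
    \<comment> \<open>Reducing the danger at \<open>v\<close> may add one color to that at
      \<open>u\<close>, which thus becomes at most 5.\<close>
    obtain \<phi>2 where p2: "partial_avd D \<phi>2" "card (danger D \<phi>2 v) \<le> 4"
      "color_set D \<phi>2 v \<noteq> color_set D \<phi>1 u" "color_set D \<phi>2 u = color_set D \<phi>1 u"
      "card (danger D \<phi>2 u) \<le> card (danger D \<phi>1 u) + 1"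
      using reduce_danger[OF p1(1) v, of "color_set D \<phi>1 u"] p1(3,4) u uv_neq by metis
    have "3 \<le> \<Delta> div 2" using False by linarith
    then show ?thesis using that[of \<phi>2] p1 p2 palette by simp
  qed
  let ?F = "color_set D \<psi> u \<union> color_set D \<psi> v \<union> danger D \<psi> u \<union> danger D \<psi> v"
  have "card ?F \<le> card (color_set D \<psi> u) + card (color_set D \<psi> v) + card (danger D \<psi> u) + card (danger D \<psi> v)"
    by (meson add_le_mono card_Un_le le_refl le_trans)
  also have "\<dots> < K"
    using card_color_set_less[OF D u, of \<psi>] card_color_set_less[OF D v, of \<psi>] psi(3) by linarith
  finally have card_F: "card ?F < K" .
  have "finite ?F"
    using finite_color_set[OF finite_sub[OF D]] finite_danger(1)[OF D] by blast
  then obtain b where b: "b \<in> {1..K}" "b \<notin> ?F" by (rule finite_ex_notin[OF _ card_F])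
  have "partial_avd (insert {u, v} D) (\<psi>({u, v} := b))"
    using partial_avd_insert[OF psi(1) uv b(1)] b(2) psi(2) by blast
  then show ?thesis using that by blast
qed

end

section \<open>An edge order that leaves room for distinguishing\<close>

text \<open>The coloring order is the reverse of this construction.\<close>

inductive buildable :: "'a set set \<Rightarrow> bool" where
  empty: "buildable {}"
| pair: "buildable S \<Longrightarrow> {w, u} \<notin> S \<Longrightarrow> {u, v} \<notin> S \<Longrightarrow> v \<noteq> w \<Longrightarrow>
    buildable (insert {w, u} (insert {u, v} S))"
| touch: "buildable S \<Longrightarrow> {z, v} \<in> S \<Longrightarrow> {x, z} \<notin> S \<Longrightarrow> buildable (insert {x, z} S)"

context avd_palette
begin

text \<open>\<open>S\<close> is the set of uncolored edges. The induction colors the edges added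
  last to \<open>S\<close> and passes to the smaller set.\<close>

lemma extend_over_buildable:
  assumes "buildable S" "S \<subseteq> E" "partial_avd (E - S) \<phi>"
  shows "\<exists>\<phi>. partial_avd E \<phi>"
  using assms
proof (induction arbitrary: \<phi> rule: buildable.induct)
  case empty
  then show ?case by auto
next
  case (pair S w u v)
  let ?D = "E - insert {w, u} (insert {u, v} S)"
  have neq: "{w, u} \<noteq> {u, v}" using pair.hyps by (auto simp: doubleton_eq_iff)
  \<comment> \<open>While \<open>{w, u}\<close> is colored, \<open>{u, v}\<close> is still
    uncolored; the choice makes C(u) and C(v) differ, as \<open>color_final_edge\<close>
    demands.\<close>
  obtain \<phi>1 where p1: "partial_avd (insert {w, u} ?D) \<phi>1"
    "color_set (insert {w, u} ?D) \<phi>1 u \<noteq> color_set (insert {w, u} ?D) \<phi>1 v"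
    using color_nonfinal_edge[OF pair.prems(2), of w u v] pair.hyps pair.prems by auto
  then obtain \<phi>2 where "partial_avd (insert {u, v} (insert {w, u} ?D)) \<phi>2"
    using color_final_edge[OF p1(1) _ _ p1(2)] neq pair.prems by auto
  moreover have "insert {u, v} (insert {w, u} ?D) = E - S" using pair.hyps pair.prems by auto
  ultimately show ?case using pair.IH pair.prems by auto
next
  case (touch S z v x)
  let ?D = "E - insert {x, z} S"
  \<comment> \<open>The edge \<open>{z, v}\<close> belongs to \<open>S\<close>, so it is still
    uncolored when \<open>{x, z}\<close> is colored.\<close>
  have "v \<noteq> x" using touch.hyps by (auto simp: insert_commute)
  then obtain \<phi>1 where "partial_avd (insert {x, z} ?D) \<phi>1"
    using color_nonfinal_edge[OF touch.prems(2), of x z v] touch.hyps touch.prems by auto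
  moreover have "insert {x, z} ?D = E - S" using touch.hyps touch.prems by auto
  ultimately show ?case using touch.IH touch.prems by auto
qed

lemma ex_avd_edge_coloring_palette:
  assumes "buildable E"
  shows "\<exists>\<phi>. avd_edge_coloring E K \<phi>"
proof -
  \<comment> \<open>With no edge colored, no end of an edge is saturated. With all of
    \<open>E\<close> colored, every vertex is, and \<open>partial_avd\<close> becomes the full
    condition.\<close>
  have "partial_avd (E - E) \<phi>" for \<phi>
    by (auto simp: partial_avd_def edge_coloring_def saturated_def incident_edges_def)
  then obtain \<phi> where "partial_avd E \<phi>" using extend_over_buildable[OF assms] by blast
  then show ?thesis
    by (auto simp: partial_avd_def avd_edge_coloring_def saturated_def incident_edges_def)
qed

end

text \<open>A maximal buildable subset \<open>S\<close> is all of \<open>E\<close>: an edge outside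
  \<open>S\<close> that meets \<open>S\<close> could be added by \<open>touch\<close>, and
  otherwise, not being isolated, it forms a \<open>pair\<close> with an adjacent edge.\<close>

lemma buildable_edges:
  assumes fin: "finite E" and card2: "\<And>e. e \<in> E \<Longrightarrow> card e = 2"
    and iso: "\<nexists>e. isolated_edge E e"
  shows "buildable E"
proof -
  let ?B = "{S. buildable S \<and> S \<subseteq> E}"
  have "finite ?B" using fin by (intro finite_subset[of ?B "Pow E"]) auto
  moreover have "{} \<in> ?B" by (auto intro: buildable.empty)
  ultimately have "\<exists>S\<in>?B. \<forall>T\<in>?B. S \<subseteq> T \<longrightarrow> S = T" by (intro finite_has_maximal) auto
  then obtain S where S: "buildable S" "S \<subseteq> E"
    and max: "\<forall>T\<in>?B. S \<subseteq> T \<longrightarrow> S = T"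
    by auto
  have untouched: "e \<inter> f = {}" if "e \<in> E - S" "f \<in> S" for e f
  proof (rule ccontr)
    assume "e \<inter> f \<noteq> {}"
    then obtain z where z: "z \<in> e" "z \<in> f" by blast
    have "card e = 2" "card f = 2" using that card2 S(2) by auto
    then obtain x v where ef: "e = {x, z}" "f = {z, v}"
      using card_2_other_element z insert_commute by metis
    then have "buildable (insert e S)" using that buildable.touch[OF S(1), of z v x] by simp
    then show False using bspec[OF max, of "insert e S"] that S(2) by auto
  qed
  have "e \<in> S" if e: "e \<in> E" for e
  proof (rule ccontr)
    assume eS: "e \<notin> S"
    obtain u where u: "u \<in> e" "degree E u \<noteq> 1" using iso e by (auto simp: isolated_edge_def)
    have "incident_edges E u \<noteq> {e}" using u by (auto simp: degree_def)
    moreover have "e \<in> incident_edges E u" using e u by (simp add: incident_edges_def)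
    ultimately obtain f where f: "f \<in> E" "u \<in> f" "f \<noteq> e" by (auto simp: incident_edges_def)
    \<comment> \<open>\<open>f\<close> meets \<open>e\<close>, and edges of \<open>S\<close> meet no
      edge outside \<open>S\<close>.\<close>
    have fS: "f \<notin> S" using untouched[of e f] e eS u f by blast
    have "card e = 2" "card f = 2" using e f card2 by auto
    then obtain w v where ef: "e = {w, u}" "f = {u, v}"
      using card_2_other_element u(1) f(2) insert_commute by metis
    then have "v \<noteq> w" using f by (auto simp: insert_commute)
    then have "buildable (insert e (insert f S))" using ef eS fS S(1) buildable.pair by metis
    then show False using bspec[OF max, of "insert e (insert f S)"] e f(1) eS S(2) by auto
  qed
  then have "S = E" using S(2) by blast
  then show ?thesis using S(1) by simp
qed

section \<open>The bound on the chromatic index\<close>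

theorem theorem2p4:
  fixes V :: "'a set" and E :: "'a set set"
  assumes "normal_graph V E"
  shows "real (avd_chromatic_index E) \<le> 5 / 2 * (real (max_degree V E) + 2)"
proof -
  define K where "K = 5 * (max_degree V E + 2) div 2"
  have finV: "finite V" and E: "\<And>e. e \<in> E \<Longrightarrow> e \<subseteq> V \<and> card e = 2"
    and iso: "\<nexists>e. isolated_edge E e"
    using assms by (auto simp: normal_graph_def graph_def)
  have "E \<subseteq> Pow V" using E by blast
  then have finE: "finite E" using finV by (simp add: finite_subset)
  have deg: "degree E v \<le> max_degree V E" for v
  proof (cases "v \<in> V")
    case True
    then show ?thesis using finV by (auto simp: max_degree_def)
  next
    case False
    then have "incident_edges E v = {}" using E by (auto simp: incident_edges_def)
    then show ?thesis by (simp add: degree_def)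
  qed
  \<comment> \<open>The palette condition holds with equality, because 5 (\<Delta> + 2) = 2
    (2\<Delta> + 5) + \<Delta>.\<close>
  interpret avd_palette E "max_degree V E" K
    using finE E deg by unfold_locales (auto simp: K_def)
  obtain \<phi> where "avd_edge_coloring E K \<phi>"
    using ex_avd_edge_coloring_palette buildable_edges[OF finE _ iso] E by blast
  then have "avd_chromatic_index E \<le> K"
    unfolding avd_chromatic_index_def by (intro Least_le) blast
  then have "2 * avd_chromatic_index E \<le> 5 * (max_degree V E + 2)"
    unfolding K_def by linarith
  then have "real (2 * avd_chromatic_index E) \<le> real (5 * (max_degree V E + 2))"
    by (simp only: of_nat_le_iff)
  then show ?thesis by simp
qed

end
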